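(* Let $\nu\in(0,1]$, $\lambda_\alpha,\lambda_\beta>0$ and let $k\ge1$ be an integer. Let $Y_\beta^\nu(t)$, $t>0$, be a fractional linear pure birth process with rate $\lambda_\beta$ and one progenitor, let $$\phi_k^\nu=\inf(t\colon Y_\beta^\nu(t)=k),$$ with probability density $$\Pr\{\phi_k^\nu\in\mathrm dt\}/\mathrm dt=\sum_{l=1}^k\binom kl(-1)^{l-1}\lambda_\beta\, l\, t^{\nu-1}E_{\nu,\nu}(-\lambda_\beta l t^\nu),\qquad t>0,$$ and let $N_\alpha$ be a homogeneous Poisson process with rate $\lambda_\alpha$ independent of $Y_\beta^\nu$. Then for $|u|<1$, $$\mathbb{E}u^{N_\alpha(\phi_k^\nu)}=\frac{k!\,\Gamma\!\left(\frac{\lambda_\alpha^\nu(1-u)^\nu}{\lambda_\beta}+1\right)}{\Gamma\!\left(\frac{\lambda_\alpha^\nu(1-u)^\nu}{\lambda_\beta}+1+k\right)}=k\cdot\mathrm{Beta}\!\left(k,\frac{\lambda_\alpha^\nu(1-u)^\nu}{\lambda_\beta}+1\right).$$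
   Context: The fractional linear pure birth process with rate $\lambda_\beta$ has state probabilities $\Pr\{Y_\beta^\nu(t)=m\mid Y_\beta^\nu(0)=1\}=\sum_{j=1}^m\binom{m-1}{j-1}(-1)^{j-1}E_{\nu,1}(-\lambda_\beta j t^\nu)$, $m\ge1$; for $\nu=1$ it is the classical Yule--Furry process. Here $E_{\nu,\gamma}(x)=\sum_{r=0}^\infty\frac{x^r}{\Gamma(\nu r+\gamma)}$ is the Mittag--Leffler function, $\mathrm{Beta}(a,b)=\Gamma(a)\Gamma(b)/\Gamma(a+b)$ is the Beta function, and $(1-u)^\nu$ is the principal power.
   Formalization: With one progenitor and the given state probabilities, inf(t: Y=k) cannot have the stated density (for k=1 it is 0); the formal theorem lets φ_k be the hitting time of k or of k+1 (the k-th birth), and the latter has that density. *)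

theory Defs
  imports "HOL-Probability.Probability"
begin

definition mittag_leffler :: "real \<Rightarrow> real \<Rightarrow> real \<Rightarrow> real" where
  "mittag_leffler \<nu> \<gamma> x = (\<Sum>r. x ^ r / Gamma (\<nu> * real r + \<gamma>))"

context prob_space
begin

definition poisson_process :: "real \<Rightarrow> (real \<Rightarrow> 'a \<Rightarrow> nat) \<Rightarrow> bool" where
  "poisson_process rate N \<longleftrightarrow>
     (\<forall>t\<ge>0. random_variable (count_space UNIV) (N t)) \<and>
     (\<forall>\<omega>\<in>space M. N 0 \<omega> = 0 \<and> mono_on {0..} (\<lambda>t. N t \<omega>) \<and>
        (\<forall>t\<ge>0. continuous (at_right t) (\<lambda>s. N s \<omega>))) \<and>
     (\<forall>s t. 0 \<le> s \<longrightarrow> s < t \<longrightarrow>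
        distr M (count_space UNIV) (\<lambda>\<omega>. N t \<omega> - N s \<omega>)
          = measure_pmf (poisson_pmf (rate * (t - s)))) \<and>
     (\<forall>(n::nat) \<tau>. (\<forall>i. 0 \<le> \<tau> i) \<longrightarrow> mono \<tau> \<longrightarrow>
        indep_vars (\<lambda>_. count_space UNIV) (\<lambda>i \<omega>. N (\<tau> (Suc i)) \<omega> - N (\<tau> i) \<omega>) {..<n})"

text \<open>The one-dimensional laws are prescribed by the Mittag-Leffler formula.  The remaining
  clauses express that the process is a pure birth process with one progenitor: for a
  nondecreasing path started in 1, the image being exactly the set of positive integers says that
  births occur one at a time and that every level is reached.\<close>

definition fractional_linear_birth_process ::
    "real \<Rightarrow> real \<Rightarrow> (real \<Rightarrow> 'a \<Rightarrow> nat) \<Rightarrow> bool" where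
  "fractional_linear_birth_process \<nu> rate Y \<longleftrightarrow>
     (\<forall>t\<ge>0. random_variable (count_space UNIV) (Y t)) \<and>
     (\<forall>\<omega>\<in>space M. Y 0 \<omega> = 1 \<and> mono_on {0..} (\<lambda>t. Y t \<omega>) \<and>
        (\<forall>t\<ge>0. continuous (at_right t) (\<lambda>s. Y s \<omega>)) \<and>
        (\<lambda>t. Y t \<omega>) ` {0..} = {1..}) \<and>
     (\<forall>t>0. \<forall>m\<ge>1. prob {\<omega> \<in> space M. Y t \<omega> = m} =
        (\<Sum>j = 1..m. real ((m - 1) choose (j - 1)) * (-1) ^ (j - 1) *
           mittag_leffler \<nu> 1 (- rate * real j * t powr \<nu>)))"

definition indep_processes ::
    "(real \<Rightarrow> 'a \<Rightarrow> nat) \<Rightarrow> (real \<Rightarrow> 'a \<Rightarrow> nat) \<Rightarrow> bool" where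
  "indep_processes X Y \<longleftrightarrow>
     indep_var (Pi\<^sub>M {0..} (\<lambda>_. count_space UNIV)) (\<lambda>\<omega>. \<lambda>t\<in>{0..}. X t \<omega>)
               (Pi\<^sub>M {0..} (\<lambda>_. count_space UNIV)) (\<lambda>\<omega>. \<lambda>t\<in>{0..}. Y t \<omega>)"

end

definition hitting_time :: "(real \<Rightarrow> 'a \<Rightarrow> nat) \<Rightarrow> nat \<Rightarrow> 'a \<Rightarrow> real" where
  "hitting_time Y n \<omega> = Inf {t. 0 \<le> t \<and> Y t \<omega> = n}"

text \<open>For \<open>\<nu> = 1\<close> this is the density of a sum of independent exponential variables with
  rates \<open>rate\<close>, \<open>2 * rate\<close>, ..., \<open>k * rate\<close>, that is, of the time of the \<open>k\<close>-th birth.  A process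
  with state probabilities as above, progenitor included, has this density for its hitting time of
  \<open>k + 1\<close>; the hitting time of \<open>k\<close> cannot have it (for \<open>k = 1\<close> that time is 0).\<close>

definition birth_time_density :: "real \<Rightarrow> real \<Rightarrow> nat \<Rightarrow> real \<Rightarrow> real" where
  "birth_time_density \<nu> rate k t =
     (if 0 < t then
        (\<Sum>l = 1..k. real (k choose l) * (-1) ^ (l - 1) * rate * real l * t powr (\<nu> - 1) *
           mittag_leffler \<nu> \<nu> (- rate * real l * t powr \<nu>))
      else 0)"

end

(*
  Conditioning on the birth time phi turns the generating function of the Poisson process into the
  Laplace transform E exp(-z phi) at z = rate (1 - u), where Re z > 0.  For large real z this
  transform is found by integrating the Mittag-Leffler series termwise, each term
  t^(nu-1) E_{nu,nu}(-c t^nu) contributing 1 / (z^nu + c); this fails for small |z|, but E exp(-z phi)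
  is holomorphic for Re z > 0, so analytic continuation gives the value everywhere.  A partial
  fraction expansion turns the resulting alternating binomial sum into a quotient of Gamma values.
*)
theory Submission
  imports Defs "HOL-Complex_Analysis.Complex_Analysis"
begin

text \<open>Termwise integration needs absolute convergence. The integrals of the absolute values of
  the terms form a geometric series of ratio c / z^\<nu>, hence the restriction to large real z.
  Holomorphy is therefore taken from the random variable and not from the series: phi is
  nonnegative, so exp(-z phi) is bounded by 1 for Re z > 0. The continuation takes place on a single
  disc |w - a| < a chosen for the given z; such discs exhaust the right half-plane, and on each of
  them the transform has an explicit power series. The sign of the density is a separate obstacle.
  The density is an alternating sum, and it enters the hypotheses under \<open>ennreal\<close>,
  which sends negative values to 0, so its nonnegativity must be known before expectations become
  Lebesgue integrals. It is read off from the monotone paths of the birth process, which avoids a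
  study of the complete monotonicity of Mittag-Leffler functions.\<close>

section \<open>The Mittag-Leffler series: convergence, derivative, Laplace transform\<close>

text \<open>Euler's integrand is at least the left-hand side on [T, T + 1], and the rest of the
  integral is nonnegative. Since T is free, Gamma outgrows every geometric sequence.\<close>

lemma Gamma_ge_power:
  fixes T y :: real
  assumes "1 \<le> T" "1 \<le> y"
  shows "T powr (y - 1) * exp (- (T + 1)) \<le> Gamma y"
proof -
  have I: "((\<lambda>t. t powr (y - 1) / exp t) has_integral Gamma y) {0..}"
    using Gamma_integral_real[of y] assms by simp
  have "((\<lambda>t. T powr (y - 1) * exp (- (T + 1))) has_integral T powr (y - 1) * exp (- (T + 1))) {T..T+1}"
    using has_integral_const_real[of "T powr (y - 1) * exp (- (T + 1))" T "T+1"] by simp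
  moreover have "(\<lambda>t. t powr (y - 1) / exp t) integrable_on {T..T+1}"
    by (intro integrable_continuous_real continuous_intros) (use assms in auto)
  ultimately have "T powr (y - 1) * exp (- (T + 1)) \<le> integral {T..T+1} (\<lambda>t. t powr (y - 1) / exp t)"
  proof (intro has_integral_le[OF _ integrable_integral])
    fix t assume t: "t \<in> {T..T+1}"
    have "T powr (y - 1) * exp (- (T + 1)) \<le> t powr (y - 1) * exp (- t)"
      using t assms by (intro mult_mono powr_mono2) auto
    then show "T powr (y - 1) * exp (- (T + 1)) \<le> t powr (y - 1) / exp t"
      by (simp add: exp_minus divide_inverse)
  qed auto
  also have "\<dots> \<le> integral {0..} (\<lambda>t. t powr (y - 1) / exp t)"
    using I assms by (intro integral_subset_le) (auto intro!: integrable_continuous_real continuous_intros)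
  also have "\<dots> = Gamma y"
    using I by (rule integral_unique)
  finally show ?thesis .
qed

lemma summable_mittag_leffler:
  fixes \<nu> \<gamma> x :: real
  assumes "0 < \<nu>" "0 < \<gamma>"
  shows "summable (\<lambda>r. x ^ r / Gamma (\<nu> * real r + \<gamma>))"
proof -
  \<comment> \<open>With T^\<nu> >= 2|x| the lower bound for Gamma dominates the terms by a
    geometric series of ratio 1/2; \<open>C\<close> collects the factors that do not depend on
    r.\<close>
  define T where "T = max 1 ((2 * \<bar>x\<bar>) powr (1 / \<nu>))"
  have T: "1 \<le> T" "2 * \<bar>x\<bar> \<le> T powr \<nu>"
  proof -
    have "2 * \<bar>x\<bar> = ((2 * \<bar>x\<bar>) powr (1 / \<nu>)) powr \<nu>"
      using assms by (simp add: powr_powr)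
    also have "\<dots> \<le> T powr \<nu>"
      using assms by (intro powr_mono2) (auto simp: T_def)
    finally show "2 * \<bar>x\<bar> \<le> T powr \<nu>" .
  qed (simp add: T_def)
  define C where "C = T powr (1 - \<gamma>) * exp (T + 1)"
  show ?thesis
  proof (rule summable_comparison_test_ev)
    show "summable (\<lambda>r. C * (1 / 2 :: real) ^ r)"
      by (intro summable_mult summable_geometric) auto
    show "\<forall>\<^sub>F r in sequentially. norm (x ^ r / Gamma (\<nu> * real r + \<gamma>)) \<le> C * (1 / 2) ^ r"
    \<comment> \<open>From this index on \<nu> r >= 1, so the argument of Gamma lies in the range of
      \<open>Gamma_ge_power\<close>.\<close>
    proof (rule eventually_sequentiallyI[of "nat \<lceil>1 / \<nu>\<rceil>"])
      fix r assume "nat \<lceil>1 / \<nu>\<rceil> \<le> r"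
      then have "1 / \<nu> \<le> real r" by linarith
      then have y: "1 \<le> \<nu> * real r + \<gamma>"
        using assms by (simp add: field_simps)
      have G: "0 < T powr (\<nu> * real r + \<gamma> - 1) * exp (- (T + 1))" using T by simp
      have "norm (x ^ r / Gamma (\<nu> * real r + \<gamma>)) = \<bar>x\<bar> ^ r / Gamma (\<nu> * real r + \<gamma>)"
        using y by (simp add: power_abs abs_of_pos Gamma_real_pos)
      also have "\<dots> \<le> \<bar>x\<bar> ^ r / (T powr (\<nu> * real r + \<gamma> - 1) * exp (- (T + 1)))"
        using Gamma_ge_power[OF T(1) y] G by (intro divide_left_mono mult_pos_pos) (auto intro: less_le_trans)
      also have "\<dots> = C * (\<bar>x\<bar> / T powr \<nu>) ^ r"
      proof -
        have "T powr (\<nu> * real r + \<gamma> - 1) = (T powr \<nu>) ^ r / T powr (1 - \<gamma>)"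
          using T by (simp add: powr_add powr_diff powr_realpow[symmetric] powr_powr)
        then show ?thesis
          unfolding C_def exp_minus by (simp add: power_divide field_simps del: exp_add)
      qed
      also have "\<dots> \<le> C * (1 / 2) ^ r"
        using T by (intro mult_left_mono power_mono) (auto simp: C_def field_simps)
      finally show "norm (x ^ r / Gamma (\<nu> * real r + \<gamma>)) \<le> C * (1 / 2) ^ r" .
    qed
  qed
qed

text \<open>In the differentiated series the factor r + 1 cancels against Gamma(\<nu>(r+1) + 1) =
  \<nu>(r+1) Gamma(\<nu> r + \<nu>). This leaves 1/\<nu> and shifts the second parameter from 1 to
  \<nu>.\<close>

lemma mittag_leffler_has_derivative:
  fixes \<nu> x :: real
  assumes "0 < \<nu>"
  shows "(mittag_leffler \<nu> 1 has_real_derivative mittag_leffler \<nu> \<nu> x / \<nu>) (at x)"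
proof -
  define c where "c r = 1 / Gamma (\<nu> * real r + 1)" for r
  have "((\<lambda>x. \<Sum>r. c r * x ^ r) has_real_derivative (\<Sum>r. diffs c r * x ^ r)) (at x)"
    by (rule termdiffs_strong_converges_everywhere)
       (use summable_mittag_leffler[OF assms, of 1] in \<open>simp add: c_def\<close>)
  moreover have "(\<lambda>x. \<Sum>r. c r * x ^ r) = mittag_leffler \<nu> 1"
    by (simp add: mittag_leffler_def c_def fun_eq_iff)
  moreover have "diffs c r * x ^ r = x ^ r / Gamma (\<nu> * real r + \<nu>) / \<nu>" for r
  proof -
    have "Gamma (\<nu> * real (Suc r) + 1) = (\<nu> * real (Suc r)) * Gamma (\<nu> * real (Suc r))"
      using mult_pos_pos[OF assms, of "real (Suc r)"] by (intro Gamma_plus1) (auto simp del: of_nat_Suc)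
    also have "\<nu> * real (Suc r) = \<nu> * real r + \<nu>"
      by (simp add: algebra_simps)
    finally have "Gamma (\<nu> * real r + \<nu> + 1) = real (Suc r) * (\<nu> * Gamma (\<nu> * real r + \<nu>))"
      by (simp add: algebra_simps)
    moreover have "\<nu> * real (Suc r) = \<nu> * real r + \<nu>"
      by (simp add: algebra_simps)
    ultimately show ?thesis
      unfolding diffs_def c_def by (simp del: of_nat_Suc)
  qed
  moreover have "(\<Sum>r. x ^ r / Gamma (\<nu> * real r + \<nu>) / \<nu>) = mittag_leffler \<nu> \<nu> x / \<nu>"
    unfolding mittag_leffler_def using assms by (intro suminf_divide summable_mittag_leffler)
  ultimately show ?thesis by simp
qed

text \<open>The link between the state probabilities, built from E_{\<nu>,1}, and the density, built
  from E_{\<nu>,\<nu>}; the factor \<nu> of the chain rule cancels the 1/\<nu> above.\<close>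

lemma mittag_leffler_powr_has_derivative:
  fixes \<nu> c t :: real
  assumes "0 < \<nu>" "0 < t"
  shows "((\<lambda>t. mittag_leffler \<nu> 1 (- c * t powr \<nu>)) has_real_derivative
           - (c * t powr (\<nu> - 1) * mittag_leffler \<nu> \<nu> (- c * t powr \<nu>))) (at t)"
proof -
  have "((\<lambda>t. - c * t powr \<nu>) has_real_derivative - c * (\<nu> * t powr (\<nu> - 1))) (at t)"
    using assms by (auto intro!: derivative_eq_intros)
  from DERIV_chain2[OF mittag_leffler_has_derivative[OF assms(1)] this] show ?thesis
    using assms by (simp add: field_simps)
qed

lemma has_bochner_integral_Gamma:
  fixes a z :: real
  assumes "0 < a" "0 < z"
  shows "has_bochner_integral lborel (\<lambda>t. indicator {0<..} t * (t powr (a - 1) * exp (- z * t))) (Gamma a / z powr a)"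
proof (rule has_bochner_integral_nn_integral)
  have "ennreal (Gamma a) = (\<integral>\<^sup>+t. ennreal (indicator {0..} t * t powr (a - 1) / exp t) \<partial>lborel)"
    using Gamma_conv_nn_integral_real[OF assms(1)] .
  also have "\<dots> = z * (\<integral>\<^sup>+t. ennreal (indicator {0..} (z * t) * (z * t) powr (a - 1) / exp (z * t)) \<partial>lborel)"
    using assms by (subst nn_integral_real_affine[where c = z and t = 0]) auto
  \<comment> \<open>The closed half-line may be replaced by the open one pointwise, because
    \<open>0 powr x\<close> is 0 by convention.\<close>
  also have "\<dots> = (\<integral>\<^sup>+t. ennreal (z powr a) * ennreal (indicator {0<..} t * (t powr (a - 1) * exp (- z * t))) \<partial>lborel)"
    using assms
    by (subst nn_integral_cmult[symmetric])
       (auto intro!: nn_integral_cong simp: indicator_def zero_less_mult_iff powr_mult exp_minus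
          ennreal_mult'[symmetric] powr_diff field_simps zero_le_mult_iff)
  also have "\<dots> = ennreal (z powr a) * (\<integral>\<^sup>+t. ennreal (indicator {0<..} t * (t powr (a - 1) * exp (- z * t))) \<partial>lborel)"
    by (rule nn_integral_cmult) auto
  finally have "ennreal (1 / z powr a) * ennreal (Gamma a) = ennreal (1 / z powr a) * (ennreal (z powr a) *
      (\<integral>\<^sup>+t. ennreal (indicator {0<..} t * (t powr (a - 1) * exp (- z * t))) \<partial>lborel))"
    by simp
  then show "(\<integral>\<^sup>+t. ennreal (indicator {0<..} t * (t powr (a - 1) * exp (- z * t))) \<partial>lborel) = ennreal (Gamma a / z powr a)"
    using assms by (simp add: mult.assoc[symmetric] ennreal_mult'[symmetric] ennreal_mult''[symmetric])
  show "0 \<le> Gamma a / z powr a"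
    using assms Gamma_real_pos[of a] by simp
qed (auto simp: indicator_def)

text \<open>The r-th term integrates to (-c / z^\<nu>)^r / z^\<nu> by Euler's integral, since its
  Gamma factor cancels. The hypothesis c < z^\<nu> makes the series of absolute values converge, and
  the signed geometric series sums to 1 / (z^\<nu> + c).\<close>

lemma mittag_leffler_laplace:
  fixes \<nu> c z :: real
  assumes "0 < \<nu>" "0 < c" "0 < z" "c < z powr \<nu>"
  shows "has_bochner_integral lborel
           (\<lambda>t. indicator {0<..} t * (t powr (\<nu> - 1) * mittag_leffler \<nu> \<nu> (- c * t powr \<nu>) * exp (- z * t)))
           (1 / (z powr \<nu> + c))"
proof -
  define h where "h r t = (- c) ^ r / Gamma (\<nu> * real r + \<nu>) *
    (indicator {0<..} t * (t powr (\<nu> * real r + \<nu> - 1) * exp (- z * t)))" for r t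
  have a: "0 < \<nu> * real r + \<nu>" for r
    using assms by (simp add: add_nonneg_pos)
  have G: "0 < Gamma (\<nu> * real r + \<nu>)" for r
    using a by (rule Gamma_real_pos)
  have zp: "z powr (\<nu> * real r + \<nu>) = (z powr \<nu>) ^ r * z powr \<nu>" for r
    using assms by (simp add: powr_add powr_realpow[symmetric] powr_powr)
  have h: "has_bochner_integral lborel (h r) ((- c / z powr \<nu>) ^ r / z powr \<nu>)" for r
  proof -
    have "has_bochner_integral lborel (h r)
            ((- c) ^ r / Gamma (\<nu> * real r + \<nu>) * (Gamma (\<nu> * real r + \<nu>) / z powr (\<nu> * real r + \<nu>)))"
      unfolding h_def by (intro has_bochner_integral_mult_right has_bochner_integral_Gamma a assms) 
    then show ?thesis
      using less_imp_neq[OF G, of r] unfolding zp power_divide by (simp add: mult.commute)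
  qed
  have nh: "norm (h r t) = c ^ r / Gamma (\<nu> * real r + \<nu>) *
    (indicator {0<..} t * (t powr (\<nu> * real r + \<nu> - 1) * exp (- z * t)))" for r t
    using G[of r] assms by (simp add: h_def abs_mult power_abs)
  have Inh: "(\<integral>t. norm (h r t) \<partial>lborel) = (c / z powr \<nu>) ^ r / z powr \<nu>" for r
  proof -
    have "has_bochner_integral lborel (\<lambda>t. norm (h r t))
            (c ^ r / Gamma (\<nu> * real r + \<nu>) * (Gamma (\<nu> * real r + \<nu>) / z powr (\<nu> * real r + \<nu>)))"
      unfolding nh by (intro has_bochner_integral_mult_right has_bochner_integral_Gamma a assms) 
    then show ?thesis
      using less_imp_neq[OF G, of r] unfolding zp power_divide by (simp add: mult.commute has_bochner_integral_iff)
  qed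
  have hs: "h r t = (indicator {0<..} t * t powr (\<nu> - 1) * exp (- z * t)) *
      ((- c * t powr \<nu>) ^ r / Gamma (\<nu> * real r + \<nu>))" for r t
  proof (cases "0 < t")
    case True
    then have "t powr (\<nu> * real r + \<nu> - 1) = (t powr \<nu>) ^ r * t powr (\<nu> - 1)"
      by (simp add: powr_add powr_diff powr_realpow[symmetric] powr_powr)
    then show ?thesis by (simp add: h_def power_mult_distrib[symmetric])
  qed (simp add: h_def)
  have sm: "summable (\<lambda>r. norm (h r t))" for t
  proof -
    have "summable (\<lambda>r. (indicator {0<..} t * t powr (\<nu> - 1) * exp (- z * t)) *
        ((c * t powr \<nu>) ^ r / Gamma (\<nu> * real r + \<nu>)))"
      using assms by (intro summable_mult summable_mittag_leffler)
    moreover have "norm (h r t) = (indicator {0<..} t * t powr (\<nu> - 1) * exp (- z * t)) *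
        ((c * t powr \<nu>) ^ r / Gamma (\<nu> * real r + \<nu>))" for r
      unfolding hs using G[of r] assms by (simp add: abs_mult power_abs)
    ultimately show ?thesis by simp
  qed
  have sI: "summable (\<lambda>r. \<integral>t. norm (h r t) \<partial>lborel)"
    unfolding Inh using assms by (intro summable_divide summable_geometric) auto
  have hi: "integrable lborel (h r)" for r
    using h by (rule integrable.intros)
  have eq: "(\<Sum>r. h r t) = indicator {0<..} t * (t powr (\<nu> - 1) * mittag_leffler \<nu> \<nu> (- c * t powr \<nu>) * exp (- z * t))" for t
    unfolding hs mittag_leffler_def
    using suminf_mult[OF summable_mittag_leffler[OF assms(1,1), of "- c * t powr \<nu>"],
        of "indicator {0<..} t * t powr (\<nu> - 1) * exp (- z * t)"]
    by (simp add: mult_ac)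
  have "(\<lambda>r. (- c / z powr \<nu>) ^ r / z powr \<nu>) sums ((1 / (1 - (- c / z powr \<nu>))) / z powr \<nu>)"
    using assms by (intro sums_divide geometric_sums) auto
  moreover have "(1 / (1 - (- c / z powr \<nu>))) / z powr \<nu> = 1 / (z powr \<nu> + c)"
  proof -
    have "0 < z powr \<nu> + c" using assms by (simp add: add_pos_pos)
    then show ?thesis using assms by (simp add: divide_simps)
  qed
  ultimately have "(\<Sum>r. integral\<^sup>L lborel (h r)) = 1 / (z powr \<nu> + c)"
    using h by (simp add: has_bochner_integral_iff sums_iff)
  then show ?thesis
    using integrable_suminf[OF hi _ sI] integral_suminf[OF hi _ sI] sm
    by (simp add: has_bochner_integral_iff eq)
qed

section \<open>Partial fractions, and holomorphy of Laplace transforms\<close>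

text \<open>The sum is the k-th alternating difference of 1/w. By Pascal's rule the sum for k + 1 at
  w is the sum for k at w minus the sum for k at w + 1, which is why the induction generalises over
  w.\<close>

lemma alternating_binomial_partial_fractions:
  fixes w :: "'a :: field_char_0"
  assumes "\<And>l. w + of_nat l \<noteq> 0"
  shows "(\<Sum>l\<le>k. (-1) ^ l * of_nat (k choose l) / (w + of_nat l)) = fact k / pochhammer w (Suc k)"
  using assms
proof (induction k arbitrary: w)
  case (Suc k)
  define a where "a l = (-1) ^ l / (w + of_nat l)" for l
  have "(\<Sum>l\<le>Suc k. (-1) ^ l * of_nat (Suc k choose l) / (w + of_nat l)) =
      (\<Sum>l\<le>Suc k. of_nat (Suc k choose l) * a l)"
    by (simp add: a_def mult.commute)
  also have "\<dots> = a 0 + (\<Sum>l\<le>k. of_nat (k choose Suc l) * a (Suc l)) + (\<Sum>l\<le>k. of_nat (k choose l) * a (Suc l))"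
    by (subst sum.atMost_Suc_shift) (simp add: algebra_simps sum.distrib)
  also have "a 0 + (\<Sum>l\<le>k. of_nat (k choose Suc l) * a (Suc l)) = (\<Sum>l\<le>Suc k. of_nat (k choose l) * a l)"
    by (subst sum.atMost_Suc_shift) simp
  \<comment> \<open>The index l = k + 1 drops out because \<open>k choose Suc k\<close> is
    0.\<close>
  also have "\<dots> = (\<Sum>l\<le>k. (-1) ^ l * of_nat (k choose l) / (w + of_nat l))"
    by (simp add: a_def mult.commute)
  also have "\<dots> = fact k / pochhammer w (Suc k)"
    by (rule Suc.IH) (rule Suc.prems)
  also have "(\<Sum>l\<le>k. of_nat (k choose l) * a (Suc l)) =
      - (\<Sum>l\<le>k. (-1) ^ l * of_nat (k choose l) / ((w + 1) + of_nat l))"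
    by (simp add: a_def mult.commute add_ac sum_negf[symmetric])
  also have "\<dots> = - (fact k / pochhammer (w + 1) (Suc k))"
  proof (subst Suc.IH)
    show "w + 1 + of_nat l \<noteq> 0" for l
      using Suc.prems[of "Suc l"] by (simp add: add_ac)
  qed simp
  also have "fact k / pochhammer w (Suc k) + - (fact k / pochhammer (w + 1) (Suc k)) =
      fact (Suc k) / pochhammer w (Suc (Suc k))"
  proof -
    have n0: "w \<noteq> 0" "w + of_nat (Suc k) \<noteq> 0"
      using Suc.prems[of 0] Suc.prems[of "Suc k"] by auto
    have p: "pochhammer (w + 1) k \<noteq> 0"
      using Suc.prems[of "Suc _"] by (auto simp: pochhammer_eq_0_iff eq_neg_iff_add_eq_0 add_ac)
    \<comment> \<open>All three denominators are expressed through the common factor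
      \<open>pochhammer (w + 1) k\<close>, so that only rational arithmetic remains.\<close>
    have e: "pochhammer w (Suc k) = w * pochhammer (w + 1) k"
      "pochhammer (w + 1) (Suc k) = pochhammer (w + 1) k * (w + of_nat (Suc k))"
      "pochhammer w (Suc (Suc k)) = w * (pochhammer (w + 1) k * (w + of_nat (Suc k)))"
      unfolding pochhammer_rec[of w] pochhammer_Suc[of "w + 1"] by (simp_all add: add_ac)
    show ?thesis
      unfolding e using n0 p by (simp add: divide_simps) (simp add: algebra_simps)
  qed
  finally show ?case .
qed simp

(* On |z - a| < a the exponential series of exp(-(z - a) phi) is dominated after multiplication by
   exp(-a phi), which gives a power series around a. *)
lemma (in prob_space) laplace_transform_holomorphic:
  fixes \<phi> :: "'a \<Rightarrow> real" and a :: real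
  assumes [measurable]: "random_variable borel \<phi>" and nonneg: "\<And>\<omega>. \<omega> \<in> space M \<Longrightarrow> 0 \<le> \<phi> \<omega>"
  shows "(\<lambda>z. \<integral>\<omega>. exp (- z * complex_of_real (\<phi> \<omega>)) \<partial>M) holomorphic_on ball (complex_of_real a) a"
proof (rule power_series_holomorphic)
  fix w assume w: "w \<in> ball (complex_of_real a) a"
  define f where "f n \<omega> = exp (- complex_of_real (a * \<phi> \<omega>)) *
    ((complex_of_real a - w) * complex_of_real (\<phi> \<omega>)) ^ n /\<^sub>R fact n" for n \<omega>
  define A where "A n = (\<integral>\<omega>. exp (- complex_of_real (a * \<phi> \<omega>)) * (- complex_of_real (\<phi> \<omega>)) ^ n /\<^sub>R fact n \<partial>M)" for n
  have [measurable]: "f n \<in> borel_measurable M" for n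
    unfolding f_def by measurable
  have r: "cmod (complex_of_real a - w) \<le> a"
    using w by (simp add: dist_norm)
  have sm: "(\<lambda>n. norm (f n \<omega>)) sums (exp (- a * \<phi> \<omega>) * exp (cmod (complex_of_real a - w) * \<phi> \<omega>))" if "\<omega> \<in> space M" for \<omega>
  proof -
    have eq: "norm (f n \<omega>) = exp (- a * \<phi> \<omega>) * ((cmod (complex_of_real a - w) * \<phi> \<omega>) ^ n /\<^sub>R fact n)" for n
      using nonneg[OF that] by (simp add: f_def norm_mult norm_power)
    show ?thesis
      unfolding eq by (intro sums_mult exp_converges)
  qed
  have le1: "exp (- a * \<phi> \<omega>) * exp (cmod (complex_of_real a - w) * \<phi> \<omega>) \<le> 1" if "\<omega> \<in> space M" for \<omega>
    using mult_right_mono[OF r nonneg[OF that]] by (simp add: exp_add[symmetric])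
  \<comment> \<open>This one bound yields both the integrability of each \<open>f n\<close> and the
    summability of the integrals of the norms.\<close>
  have partial: "(\<Sum>n<N. norm (f n \<omega>)) \<le> 1" if "\<omega> \<in> space M" for \<omega> N
    using sum_le_suminf[of "\<lambda>n. norm (f n \<omega>)" "{..<N}"] sm[OF that] le1[OF that] by (simp add: sums_iff)
  have int: "integrable M (f n)" for n
  proof (rule integrable_const_bound[where B = 1])
    show "AE \<omega> in M. norm (f n \<omega>) \<le> 1"
    proof (rule AE_I2)
      fix \<omega> assume \<omega>: "\<omega> \<in> space M"
      have "norm (f n \<omega>) \<le> (\<Sum>n<Suc n. norm (f n \<omega>))"
        by (simp add: sum_nonneg)
      also have "\<dots> \<le> 1" by (rule partial[OF \<omega>])
      finally show "norm (f n \<omega>) \<le> 1" .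
    qed
  qed simp
  have "(\<lambda>n. \<integral>\<omega>. f n \<omega> \<partial>M) sums (\<integral>\<omega>. (\<Sum>n. f n \<omega>) \<partial>M)"
  proof (rule sums_integral[OF int])
    show "AE \<omega> in M. summable (\<lambda>n. norm (f n \<omega>))"
      using sm by (intro AE_I2) (auto simp: sums_iff)
    show "summable (\<lambda>n. \<integral>\<omega>. norm (f n \<omega>) \<partial>M)"
    proof (rule summableI_nonneg_bounded[where x = 1])
      fix N
      have "(\<Sum>n<N. \<integral>\<omega>. norm (f n \<omega>) \<partial>M) = (\<integral>\<omega>. (\<Sum>n<N. norm (f n \<omega>)) \<partial>M)"
        using int by (intro Bochner_Integration.integral_sum[symmetric]) auto
      also have "\<dots> \<le> (\<integral>\<omega>. 1 \<partial>M)"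
        using int partial by (intro integral_mono Bochner_Integration.integrable_sum) auto
      finally show "(\<Sum>n<N. \<integral>\<omega>. norm (f n \<omega>) \<partial>M) \<le> 1" by (simp add: prob_space)
    qed simp
  qed
  moreover have "(\<integral>\<omega>. (\<Sum>n. f n \<omega>) \<partial>M) = (\<integral>\<omega>. exp (- w * complex_of_real (\<phi> \<omega>)) \<partial>M)"
  proof (rule Bochner_Integration.integral_cong[OF refl])
    fix \<omega>
    have "(\<lambda>n. f n \<omega>) sums (exp (- complex_of_real (a * \<phi> \<omega>)) * exp ((complex_of_real a - w) * complex_of_real (\<phi> \<omega>)))"
      using sums_mult[OF exp_converges] unfolding f_def by simp
    then show "(\<Sum>n. f n \<omega>) = exp (- w * complex_of_real (\<phi> \<omega>))"
      by (simp add: sums_iff exp_add[symmetric] algebra_simps)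
  qed
  moreover have "(\<integral>\<omega>. f n \<omega> \<partial>M) = A n * (w - complex_of_real a) ^ n" for n
  proof -
    have "f n \<omega> = exp (- complex_of_real (a * \<phi> \<omega>)) * (- complex_of_real (\<phi> \<omega>)) ^ n /\<^sub>R fact n * (w - complex_of_real a) ^ n" for \<omega>
      unfolding f_def by (simp add: power_mult_distrib[symmetric] mult.assoc) (simp add: algebra_simps)
    then show ?thesis by (simp add: A_def)
  qed
  ultimately show "(\<lambda>n. A n * (w - complex_of_real a) ^ n) sums (\<integral>\<omega>. exp (- w * complex_of_real (\<phi> \<omega>)) \<partial>M)"
    by simp
qed

section \<open>The Poisson process at an independent random time\<close>

text \<open>Splitting by the value of K reduces a random index to fixed ones, where independence can
  be applied. The events K = j are disjoint, so the norms of the pieces add up to at most 1 and the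
  sum may be exchanged with the integral.\<close>

lemma (in prob_space) integral_at_nat_random_variable:
  fixes F :: "nat \<Rightarrow> 'a \<Rightarrow> 'b :: {banach, second_countable_topology, real_normed_algebra_1}"
  assumes [measurable]: "\<And>j. F j \<in> borel_measurable M" "random_variable (count_space UNIV) K"
    and bound: "\<And>j \<omega>. \<omega> \<in> space M \<Longrightarrow> norm (F j \<omega>) \<le> 1"
  shows "(\<integral>\<omega>. F (K \<omega>) \<omega> \<partial>M) = (\<Sum>j. \<integral>\<omega>. F j \<omega> * indicator {j} (K \<omega>) \<partial>M)"
proof -
  define f where "f j \<omega> = F j \<omega> * indicator {j} (K \<omega>)" for j \<omega>
  have [measurable]: "f j \<in> borel_measurable M" for j
    unfolding f_def by (intro borel_measurable_times measurable_compose[OF assms(2)] assms(1)) simp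
  have nf: "norm (f j \<omega>) \<le> indicator {j} (K \<omega>)" if "\<omega> \<in> space M" for j \<omega>
    using bound[OF that, of j] by (auto simp: f_def indicator_def)
  have int: "integrable M (f j)" for j
    by (rule integrable_const_bound[where B = 1])
       (auto intro!: AE_I2 order.trans[OF nf] simp: indicator_def)
  have "(\<integral>\<omega>. (\<Sum>j. f j \<omega>) \<partial>M) = (\<Sum>j. \<integral>\<omega>. f j \<omega> \<partial>M)"
  proof (rule integral_suminf[OF int])
    show "AE \<omega> in M. summable (\<lambda>j. norm (f j \<omega>))"
      by (intro AE_I2 summable_finite[of "{K _}"]) (auto simp: f_def indicator_def)
    show "summable (\<lambda>j. \<integral>\<omega>. norm (f j \<omega>) \<partial>M)"
    proof (rule summableI_nonneg_bounded[where x = 1])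
      fix m
      have "(\<Sum>j<m. \<integral>\<omega>. norm (f j \<omega>) \<partial>M) = (\<integral>\<omega>. (\<Sum>j<m. norm (f j \<omega>)) \<partial>M)"
        using int by (intro Bochner_Integration.integral_sum[symmetric]) auto
      also have "\<dots> \<le> (\<integral>\<omega>. 1 \<partial>M)"
      proof (intro integral_mono Bochner_Integration.integrable_sum)
        fix \<omega> assume "\<omega> \<in> space M"
        then have "(\<Sum>j<m. norm (f j \<omega>)) \<le> (\<Sum>j<m. indicator {j} (K \<omega>))"
          by (intro sum_mono nf)
        also have "\<dots> \<le> (1 :: real)"
          using card_mono[of "{K \<omega>}" "{..<m} \<inter> {K \<omega>}"] by (simp add: indicator_def)
        finally show "(\<Sum>j<m. norm (f j \<omega>)) \<le> 1" .
      qed (use int in auto)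
      finally show "(\<Sum>j<m. \<integral>\<omega>. norm (f j \<omega>) \<partial>M) \<le> 1" by (simp add: prob_space)
    qed simp
  qed
  moreover have "(\<Sum>j. f j \<omega>) = F (K \<omega>) \<omega>" for \<omega>
    by (subst suminf_finite[of "{K \<omega>}"]) (auto simp: f_def)
  ultimately show ?thesis by (simp add: f_def)
qed

lemma poisson_pgf:
  fixes u :: complex
  assumes "0 < r"
  shows "(\<integral>k. u ^ k \<partial>measure_pmf (poisson_pmf r)) = exp (- of_real r * (1 - u))"
proof -
  have s: "(\<lambda>k. pmf (poisson_pmf r) k *\<^sub>R u ^ k) sums (of_real (exp (- r)) * exp (of_real r * u))"
  proof -
    have "pmf (poisson_pmf r) k *\<^sub>R u ^ k = of_real (exp (- r)) * ((of_real r * u) ^ k /\<^sub>R fact k)" for k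
      using assms by (simp add: scaleR_conv_of_real power_mult_distrib field_simps)
    then show ?thesis using sums_mult[OF exp_converges] by simp
  qed
  have "summable (\<lambda>k. norm (pmf (poisson_pmf r) k *\<^sub>R u ^ k))"
  proof -
    have eq: "norm (pmf (poisson_pmf r) k *\<^sub>R u ^ k) = exp (- r) * ((r * norm u) ^ k /\<^sub>R fact k)" for k
      using assms by (simp add: power_mult_distrib field_simps norm_power)
    show ?thesis unfolding eq by (intro summable_mult sums_summable[OF exp_converges])
  qed
  then have "(\<integral>k. pmf (poisson_pmf r) k *\<^sub>R u ^ k \<partial>count_space UNIV) = (\<Sum>k. pmf (poisson_pmf r) k *\<^sub>R u ^ k)"
    by (intro integral_count_space_nat) (simp add: integrable_count_space_nat_iff)
  also have "\<dots> = exp (- of_real r * (1 - u))"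
    using s by (simp add: sums_iff exp_add[symmetric] exp_of_real[symmetric] algebra_simps del: exp_of_real)
  finally show ?thesis
    unfolding measure_pmf_eq_density by (subst integral_density) auto
qed

lemma (in prob_space) poisson_process_pgf:
  fixes u :: complex
  assumes N: "poisson_process rate N" and "0 < rate" "0 \<le> s"
  shows "(\<integral>\<omega>. u ^ N s \<omega> \<partial>M) = exp (- of_real (rate * s) * (1 - u))"
\<comment> \<open>The law of \<open>N s\<close> is that of the increment over [0, s], as paths start
  at 0; increments have a prescribed law only over intervals of positive length, so s = 0 is
  separate.\<close>
proof (cases "s = 0")
  case True
  have "(\<integral>\<omega>. u ^ N s \<omega> \<partial>M) = (\<integral>\<omega>. 1 \<partial>M)"
    using N True by (intro Bochner_Integration.integral_cong) (auto simp: poisson_process_def)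
  then show ?thesis using True by (simp add: prob_space)
next
  case False
  with assms have s: "0 < s" by simp
  have [measurable]: "random_variable (count_space UNIV) (N t)" if "0 \<le> t" for t
    using N that by (simp add: poisson_process_def)
  have "(\<integral>\<omega>. u ^ N s \<omega> \<partial>M) = (\<integral>\<omega>. u ^ (N s \<omega> - N 0 \<omega>) \<partial>M)"
    using N by (intro Bochner_Integration.integral_cong) (auto simp: poisson_process_def)
  also have "\<dots> = (\<integral>k. u ^ k \<partial>distr M (count_space UNIV) (\<lambda>\<omega>. N s \<omega> - N 0 \<omega>))"
    using s by (intro integral_distr[symmetric]) auto
  also have "distr M (count_space UNIV) (\<lambda>\<omega>. N s \<omega> - N 0 \<omega>) = measure_pmf (poisson_pmf (rate * s))"
    using N s by (auto simp: poisson_process_def)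
  also have "(\<integral>k. u ^ k \<partial>measure_pmf (poisson_pmf (rate * s))) = exp (- of_real (rate * s) * (1 - u))"
    using s assms by (intro poisson_pgf) simp
  finally show ?thesis .
qed

lemma dyadic_ceiling_tendsto:
  "(\<lambda>m. of_int \<lceil>2 ^ m * x\<rceil> / 2 ^ m) \<longlonglongrightarrow> (x :: real)"
proof (rule tendsto_sandwich)
  show "\<forall>\<^sub>F m in sequentially. x \<le> of_int \<lceil>2 ^ m * x\<rceil> / 2 ^ m"
    by (intro always_eventually allI) (simp add: pos_le_divide_eq mult.commute)
  show "\<forall>\<^sub>F m in sequentially. of_int \<lceil>2 ^ m * x\<rceil> / 2 ^ m \<le> x + (1 / 2) ^ m"
  proof (intro always_eventually allI)
    fix m
    have "of_int \<lceil>2 ^ m * x\<rceil> \<le> 2 ^ m * x + 1" by linarith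
    then show "of_int \<lceil>2 ^ m * x\<rceil> / 2 ^ m \<le> x + (1 / 2) ^ m"
      by (simp add: pos_divide_le_eq power_one_over field_simps)
  qed
  show "(\<lambda>m. x + (1 / 2) ^ m) \<longlonglongrightarrow> x"
    using tendsto_add[OF tendsto_const LIMSEQ_power_zero[of "1 / 2 :: real"], of x] by simp
qed simp

text \<open>The values are discrete, so right-continuity means being constant on an interval to the
  right.\<close>

lemma eventually_nat_path_at_right:
  fixes y :: "real \<Rightarrow> nat"
  assumes "continuous (at_right t) y"
  shows "\<forall>\<^sub>F s in at_right t. y s = y t"
  using assms by (simp add: continuous_within tendsto_discrete)

lemma nat_path_tendsto_from_right:
  fixes y :: "real \<Rightarrow> nat"
  assumes "continuous (at_right t) y" "X \<longlonglongrightarrow> t" "\<And>m. t \<le> X m"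
  shows "\<forall>\<^sub>F m in sequentially. y (X m) = y t"
proof -
  obtain b where b: "t < b" "\<And>s. t < s \<Longrightarrow> s < b \<Longrightarrow> y s = y t"
    using eventually_nat_path_at_right[OF assms(1)] by (auto simp: eventually_at_right_field)
  have "\<forall>\<^sub>F m in sequentially. X m < b"
    using assms(2) b(1) by (rule order_tendstoD)
  then show ?thesis
    by eventually_elim (metis assms(3) b(2) order_le_less)
qed

(* Evaluation of a path at a random time is not measurable on the full product space, so phi is
   approximated by dyadic times from above and right-continuity of the paths is used.  The cast to
   real is there because indep_var requires both variables to have the same value type. *)
lemma (in prob_space) pgf_at_independent_time:
  fixes u :: complex and \<phi> :: "'a \<Rightarrow> real"
  assumes N: "poisson_process rate N" and "0 < rate" and u: "cmod u \<le> 1"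
    and nonneg: "\<And>\<omega>. \<omega> \<in> space M \<Longrightarrow> 0 \<le> \<phi> \<omega>"
    and indep: "\<And>s. 0 \<le> s \<Longrightarrow> indep_var borel (\<lambda>\<omega>. real (N s \<omega>)) borel \<phi>"
  shows "(\<integral>\<omega>. u ^ N (\<phi> \<omega>) \<omega> \<partial>M) = (\<integral>\<omega>. exp (- (of_real rate * (1 - u)) * of_real (\<phi> \<omega>)) \<partial>M)"
proof (rule LIMSEQ_unique)
  have [measurable]: "random_variable (count_space UNIV) (N t)" if "0 \<le> t" for t
    using N that by (simp add: poisson_process_def)
  have [measurable]: "random_variable borel \<phi>"
    using indep[of 0] by (auto dest: indep_var_rv2)
  define K where "K m \<omega> = nat \<lceil>2 ^ m * \<phi> \<omega>\<rceil>" for m :: nat and \<omega>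
  have [measurable]: "K m \<in> measurable M (count_space UNIV)" for m
    unfolding K_def by measurable
  define \<psi> where "\<psi> m \<omega> = real (K m \<omega>) / 2 ^ m" for m \<omega>
  define z where "z = of_real rate * (1 - u)"
  \<comment> \<open>With |u| <= 1 and Re z >= 0 the integrands on both sides are bounded by 1, which
    serves as the dominating function in both limits.\<close>
  have Rez: "0 \<le> Re z"
    using u complex_Re_le_cmod[of u] assms by (simp add: z_def)
  have \<psi>: "\<psi> m \<omega> = of_int \<lceil>2 ^ m * \<phi> \<omega>\<rceil> / 2 ^ m" if "\<omega> \<in> space M" for m \<omega>
    using nonneg[OF that] by (simp add: \<psi>_def K_def)
  have lim: "(\<lambda>m. \<psi> m \<omega>) \<longlonglongrightarrow> \<phi> \<omega>" if "\<omega> \<in> space M" for \<omega>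
    unfolding \<psi>[OF that] by (rule dyadic_ceiling_tendsto)
  have ge: "\<phi> \<omega> \<le> \<psi> m \<omega>" if "\<omega> \<in> space M" for m \<omega>
    unfolding \<psi>[OF that] by (simp add: pos_le_divide_eq mult.commute)
  have nu: "cmod (u ^ j) \<le> 1" for j
    using u by (simp add: norm_power power_le_one)
  have ne: "cmod (exp (- z * of_real x)) \<le> 1" if "0 \<le> x" for x
    using Rez that by (simp add: norm_exp_eq_Re)
  have limN: "(\<lambda>m. u ^ N (\<psi> m \<omega>) \<omega>) \<longlonglongrightarrow> u ^ N (\<phi> \<omega>) \<omega>" if \<omega>: "\<omega> \<in> space M" for \<omega>
  proof (rule tendsto_eventually)
    have "\<forall>\<^sub>F m in sequentially. N (\<psi> m \<omega>) \<omega> = N (\<phi> \<omega>) \<omega>"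
      using N nonneg[OF \<omega>] \<omega> lim[OF \<omega>] ge[OF \<omega>]
      by (intro nat_path_tendsto_from_right[of "\<phi> \<omega>" "\<lambda>t. N t \<omega>"]) (auto simp: poisson_process_def)
    then show "\<forall>\<^sub>F m in sequentially. u ^ N (\<psi> m \<omega>) \<omega> = u ^ N (\<phi> \<omega>) \<omega>"
      by eventually_elim simp
  qed
  have mN [measurable]: "(\<lambda>\<omega>. u ^ N (\<psi> m \<omega>) \<omega>) \<in> borel_measurable M" for m
    unfolding \<psi>_def by (rule measurable_compose_countable[where f = "\<lambda>j \<omega>. u ^ N (real j / 2 ^ m) \<omega>" and g = "K m"]) auto
  have [measurable]: "(\<lambda>\<omega>. u ^ N (\<phi> \<omega>) \<omega>) \<in> borel_measurable M"
    by (rule borel_measurable_LIMSEQ_metric[OF mN limN])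
  show "(\<lambda>m. \<integral>\<omega>. u ^ N (\<psi> m \<omega>) \<omega> \<partial>M) \<longlonglongrightarrow> (\<integral>\<omega>. u ^ N (\<phi> \<omega>) \<omega> \<partial>M)"
    by (rule integral_dominated_convergence[where w = "\<lambda>_. 1"]) (auto intro!: AE_I2 limN nu)
  \<comment> \<open>At dyadic times the identity is exact; only the passage to \<phi> is a
    limit.\<close>
  have eq: "(\<integral>\<omega>. u ^ N (\<psi> m \<omega>) \<omega> \<partial>M) = (\<integral>\<omega>. exp (- z * of_real (\<psi> m \<omega>)) \<partial>M)" for m
  proof -
    have "(\<integral>\<omega>. u ^ N (\<psi> m \<omega>) \<omega> \<partial>M) = (\<Sum>j. \<integral>\<omega>. u ^ N (real j / 2 ^ m) \<omega> * indicator {j} (K m \<omega>) \<partial>M)"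
      unfolding \<psi>_def by (rule integral_at_nat_random_variable) (auto intro: nu)
    also have "\<dots> = (\<Sum>j. \<integral>\<omega>. exp (- z * of_real (real j / 2 ^ m)) * indicator {j} (K m \<omega>) \<partial>M)"
    proof (rule arg_cong[of _ _ suminf], rule ext)
      fix j
      \<comment> \<open>The event that \<open>K m\<close> equals j depends on \<phi> alone and is
        thus independent of N at the fixed time j / 2^m. The floor undoes the cast to real.\<close>
      have "indep_var borel ((\<lambda>x. u ^ nat \<lfloor>x\<rfloor>) \<circ> (\<lambda>\<omega>. real (N (real j / 2 ^ m) \<omega>))) borel ((\<lambda>x. indicator {j} (nat \<lceil>2 ^ m * x\<rceil>) :: complex) \<circ> \<phi>)"
        by (rule indep_var_compose[OF indep]) simp_all
      then have "indep_var borel (\<lambda>\<omega>. u ^ N (real j / 2 ^ m) \<omega>) borel (\<lambda>\<omega>. indicator {j} (K m \<omega>) :: complex)"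
        by (simp add: o_def K_def)
      then have "(\<integral>\<omega>. u ^ N (real j / 2 ^ m) \<omega> * indicator {j} (K m \<omega>) \<partial>M) =
          (\<integral>\<omega>. u ^ N (real j / 2 ^ m) \<omega> \<partial>M) * (\<integral>\<omega>. indicator {j} (K m \<omega>) \<partial>M)"
        by (rule indep_var_lebesgue_integral)
           (auto intro!: integrable_const_bound[where B = 1] AE_I2 nu simp: indicator_def)
      also have "(\<integral>\<omega>. u ^ N (real j / 2 ^ m) \<omega> \<partial>M) = exp (- z * of_real (real j / 2 ^ m))"
        using assms by (subst poisson_process_pgf[OF N]) (auto simp: z_def mult_ac)
      finally show "(\<integral>\<omega>. u ^ N (real j / 2 ^ m) \<omega> * indicator {j} (K m \<omega>) \<partial>M) =
          (\<integral>\<omega>. exp (- z * of_real (real j / 2 ^ m)) * indicator {j} (K m \<omega>) \<partial>M)"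
        by simp
    qed
    also have "\<dots> = (\<integral>\<omega>. exp (- z * of_real (\<psi> m \<omega>)) \<partial>M)"
      unfolding \<psi>_def
    proof (rule integral_at_nat_random_variable[symmetric])
      show "cmod (exp (- z * of_real (real j / 2 ^ m))) \<le> 1" for j
        by (rule ne) simp
    qed simp_all
    finally show ?thesis .
  qed
  have \<psi>0: "0 \<le> \<psi> m \<omega>" for m \<omega>
    by (simp add: \<psi>_def)
  show "(\<lambda>m. \<integral>\<omega>. u ^ N (\<psi> m \<omega>) \<omega> \<partial>M) \<longlonglongrightarrow> (\<integral>\<omega>. exp (- (of_real rate * (1 - u)) * of_real (\<phi> \<omega>)) \<partial>M)"
    unfolding eq z_def[symmetric]
  proof (rule integral_dominated_convergence[where w = "\<lambda>_. 1"])
    show "(\<lambda>\<omega>. exp (- z * of_real (\<psi> m \<omega>))) \<in> borel_measurable M" for m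
      unfolding \<psi>_def by measurable
    show "AE \<omega> in M. (\<lambda>m. exp (- z * of_real (\<psi> m \<omega>))) \<longlonglongrightarrow> exp (- z * of_real (\<phi> \<omega>))"
      by (intro AE_I2 tendsto_intros lim)
    show "AE \<omega> in M. norm (exp (- z * of_real (\<psi> m \<omega>))) \<le> 1" for m
      by (intro AE_I2 ne \<psi>0)
  qed simp_all
qed

section \<open>Hitting times of the birth process\<close>

text \<open>Right-continuity makes the infimum a minimum, so y h = n; monotonicity then gives the
  equivalence. The hypothesis \<open>hit\<close> keeps the infimum from being taken over the empty
  set.\<close>

lemma hitting_time_facts:
  fixes y :: "real \<Rightarrow> nat"
  assumes mono: "mono_on {0..} y" and rc: "\<And>t. 0 \<le> t \<Longrightarrow> continuous (at_right t) y"
    and hit: "n \<in> y ` {0..}"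
  defines "h \<equiv> Inf {t. 0 \<le> t \<and> y t = n}"
  shows "0 \<le> h" and "0 \<le> t \<Longrightarrow> h \<le> t \<longleftrightarrow> n \<le> y t"
proof -
  define S where "S = {t. 0 \<le> t \<and> y t = n}"
  have S: "S \<noteq> {}" "bdd_below S"
    using hit by (auto simp: S_def)
  show h0: "0 \<le> h"
    unfolding h_def using S by (intro cInf_greatest) (auto simp: S_def)
  obtain b where b: "h < b" "\<And>s. h < s \<Longrightarrow> s < b \<Longrightarrow> y s = y h"
    using eventually_nat_path_at_right[OF rc[OF h0]] by (auto simp: eventually_at_right_field)
  obtain s where s: "s \<in> S" "s < b"
    using cInf_lessD[OF S(1), of b] b(1) unfolding h_def S_def by auto
  moreover have "h \<le> s"
    using cInf_lower[OF s(1) S(2)] by (simp add: h_def S_def)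
  \<comment> \<open>The point s of S below b is either h itself or lies where the path still has the
    value y h.\<close>
  ultimately have yh: "y h = n"
    using b(2)[of s] by (cases "s = h") (auto simp: S_def)
  show "h \<le> t \<longleftrightarrow> n \<le> y t" if t: "0 \<le> t"
  proof
    assume "h \<le> t"
    then show "n \<le> y t"
      using mono_onD[OF mono, of h t] h0 t yh by simp
  next
    assume n: "n \<le> y t"
    show "h \<le> t"
    proof (rule ccontr)
      assume "\<not> h \<le> t"
      then have "y t \<le> n"
        using mono_onD[OF mono, of t h] h0 t yh by simp
      with n t have "t \<in> S" by (simp add: S_def)
      then have "h \<le> t" using cInf_lower[OF _ S(2)] by (simp add: h_def S_def)
      with \<open>\<not> h \<le> t\<close> show False ..
    qed
  qed
qed

lemma (in prob_space) birth_hitting_time: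
  assumes Y: "fractional_linear_birth_process \<nu> rate Y" and "1 \<le> n" and "\<omega> \<in> space M"
  shows "0 \<le> hitting_time Y n \<omega>" and "0 \<le> t \<Longrightarrow> hitting_time Y n \<omega> \<le> t \<longleftrightarrow> n \<le> Y t \<omega>"
  using hitting_time_facts[of "\<lambda>t. Y t \<omega>" n] assms
  by (auto simp: hitting_time_def fractional_linear_birth_process_def)

(* The hitting time is not a measurable function of an arbitrary path; on right-continuous monotone
   paths it agrees with the infimum over rational times g, which is. *)
lemma (in prob_space) hitting_time_indep:
  assumes Y: "fractional_linear_birth_process \<nu> rate Y" and "1 \<le> n"
    and indep: "indep_processes N Y" and "0 \<le> s"
  shows "indep_var borel (\<lambda>\<omega>. real (N s \<omega>)) borel (hitting_time Y n)"
proof -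
  \<comment> \<open>The value infinity discards the times before level n is reached and makes
    \<open>g\<close> total on the product space; on actual paths the infimum is finite.\<close>
  define g :: "(real \<Rightarrow> nat) \<Rightarrow> real" where
    "g p = real_of_ereal (INF q\<in>\<rat> \<inter> {0..}. if n \<le> p q then ereal q else \<infinity>)" for p
  have [measurable]: "g \<in> borel_measurable (Pi\<^sub>M {0..} (\<lambda>_. count_space UNIV))"
    unfolding g_def
  proof (intro borel_measurable_real_of_ereal borel_measurable_INF)
    show "countable (\<rat> \<inter> {0::real..})"
      using countable_rat by (rule countable_Int1)
    fix q :: real assume "q \<in> \<rat> \<inter> {0..}"
    then have "(\<lambda>p. p q) \<in> measurable (Pi\<^sub>M {0..} (\<lambda>_. count_space UNIV :: nat measure)) (count_space UNIV)"
      by (intro measurable_component_singleton) auto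
    then show "(\<lambda>p. if n \<le> p q then ereal q else \<infinity>) \<in> borel_measurable (Pi\<^sub>M {0..} (\<lambda>_. count_space UNIV))"
      by (rule measurable_compose) simp
  qed
  have g: "hitting_time Y n \<omega> = g (\<lambda>t\<in>{0..}. Y t \<omega>)" if \<omega>: "\<omega> \<in> space M" for \<omega>
  proof -
    define h where "h = hitting_time Y n \<omega>"
    have h: "0 \<le> h" "\<And>t. 0 \<le> t \<Longrightarrow> h \<le> t \<longleftrightarrow> n \<le> Y t \<omega>"
      unfolding h_def using birth_hitting_time[OF Y \<open>1 \<le> n\<close> \<omega>] by auto
    have "(INF q\<in>\<rat> \<inter> {0..}. if n \<le> (\<lambda>t\<in>{0..}. Y t \<omega>) q then ereal q else \<infinity>) = ereal h"
    proof (rule antisym)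
      show "ereal h \<le> (INF q\<in>\<rat> \<inter> {0..}. if n \<le> (\<lambda>t\<in>{0..}. Y t \<omega>) q then ereal q else \<infinity>)"
        using h by (intro INF_greatest) auto
      show "(INF q\<in>\<rat> \<inter> {0..}. if n \<le> (\<lambda>t\<in>{0..}. Y t \<omega>) q then ereal q else \<infinity>) \<le> ereal h"
      proof (rule dense_ge)
        fix x assume "ereal h < x"
        then obtain b where b: "ereal h < ereal b" "ereal b < x"
          using ereal_dense2 by blast
        \<comment> \<open>The time h may be irrational, so it is approached by rationals from above,
          where level n has already been reached.\<close>
        obtain q where q: "q \<in> \<rat>" "h < q" "q < b"
          using Rats_dense_in_real[of h b] b(1) by auto
        then have "n \<le> (\<lambda>t\<in>{0..}. Y t \<omega>) q" "0 \<le> q"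
          using h(1) h(2)[of q] by auto
        then have "(INF q\<in>\<rat> \<inter> {0..}. if n \<le> (\<lambda>t\<in>{0..}. Y t \<omega>) q then ereal q else \<infinity>) \<le> ereal q"
          using q by (intro INF_lower2[of q]) auto
        also have "\<dots> \<le> x"
          using q b by (meson ereal_less_eq(3) less_imp_le order_trans)
        finally show "(INF q\<in>\<rat> \<inter> {0..}. if n \<le> (\<lambda>t\<in>{0..}. Y t \<omega>) q then ereal q else \<infinity>) \<le> x" .
      qed
    qed
    then show ?thesis by (simp add: g_def h_def)
  qed
  have "(\<lambda>p. p s) \<in> measurable (Pi\<^sub>M {0..} (\<lambda>_. count_space UNIV :: nat measure)) (count_space UNIV)"
    using \<open>0 \<le> s\<close> by (intro measurable_component_singleton) auto
  then have "(\<lambda>p. real (p s)) \<in> borel_measurable (Pi\<^sub>M {0..} (\<lambda>_. count_space UNIV))"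
    by (rule measurable_compose) simp
  then have *: "indep_var borel ((\<lambda>p. real (p s)) \<circ> (\<lambda>\<omega>. \<lambda>t\<in>{0..}. N t \<omega>)) borel (g \<circ> (\<lambda>\<omega>. \<lambda>t\<in>{0..}. Y t \<omega>))"
    using indep unfolding indep_processes_def by (intro indep_var_compose) auto
  have **: "((\<lambda>p. real (p s)) \<circ> (\<lambda>\<omega>. \<lambda>t\<in>{0..}. N t \<omega>)) \<omega> = real (N s \<omega>)" for \<omega>
    using \<open>0 \<le> s\<close> by simp
  \<comment> \<open>\<open>g\<close> of the path agrees with the hitting time only on
    \<open>space M\<close>. Independence is therefore transferred through its characterisation by
    distributions, which see nothing else.\<close>
  have "random_variable borel (g \<circ> (\<lambda>\<omega>. \<lambda>t\<in>{0..}. Y t \<omega>)) \<longleftrightarrow> random_variable borel (hitting_time Y n)"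
    by (rule measurable_cong) (simp add: g)
  moreover have "distr M borel (g \<circ> (\<lambda>\<omega>. \<lambda>t\<in>{0..}. Y t \<omega>)) = distr M borel (hitting_time Y n)"
    by (rule distr_cong) (simp_all add: g)
  moreover have "distr M (borel \<Otimes>\<^sub>M borel) (\<lambda>\<omega>. (real (N s \<omega>), (g \<circ> (\<lambda>\<omega>. \<lambda>t\<in>{0..}. Y t \<omega>)) \<omega>)) =
      distr M (borel \<Otimes>\<^sub>M borel) (\<lambda>\<omega>. (real (N s \<omega>), hitting_time Y n \<omega>))"
    by (rule distr_cong) (simp_all add: g)
  ultimately show ?thesis
    using * unfolding indep_var_distribution_eq ** by (simp add: o_def \<open>0 \<le> s\<close>)
qed

section \<open>The density of the birth time and its Laplace transform\<close>

text \<open>Summing the state probabilities over m <= k gives P(Y_t <= k), and this lemma turns the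
  coefficients into those of the density: the binomials (m-1 choose j-1) with j <= m <= k add up to
  (k choose j).\<close>

lemma hockey_stick_weighted_sum:
  fixes a :: "nat \<Rightarrow> real"
  shows "(\<Sum>m = 1..k. \<Sum>j = 1..m. real ((m - 1) choose (j - 1)) * a j) = (\<Sum>j = 1..k. real (k choose j) * a j)"
proof (induction k)
  case (Suc k)
  have "(\<Sum>j = 1..Suc k. real (Suc k choose j) * a j) =
      (\<Sum>j = 1..Suc k. real (k choose j) * a j) + (\<Sum>j = 1..Suc k. real (k choose (j - 1)) * a j)"
    unfolding sum.distrib[symmetric]
  proof (rule sum.cong[OF refl])
    fix j assume "j \<in> {1..Suc k}"
    then obtain i where "j = Suc i" by (cases j) auto
    then show "real (Suc k choose j) * a j = real (k choose j) * a j + real (k choose (j - 1)) * a j"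
      by (simp add: distrib_right)
  qed
  \<comment> \<open>In the first sum the top index vanishes; the second sum is the summand m = k +
    1.\<close>
  then show ?case using Suc by simp
qed simp

(* P(Y_t <= k) is nonincreasing in t and has derivative minus the density. *)
lemma (in prob_space) birth_time_density_nonneg:
  assumes Y: "fractional_linear_birth_process \<nu> rate Y" and "0 < \<nu>"
  shows "0 \<le> birth_time_density \<nu> rate k t"
proof (cases "0 < t")
  case True
  have [measurable]: "random_variable (count_space UNIV) (Y t)" if "0 \<le> t" for t
    using Y that by (simp add: fractional_linear_birth_process_def)
  have ge1: "1 \<le> Y t \<omega>" if "\<omega> \<in> space M" "0 \<le> t" for \<omega> t
  proof -
    have "Y t \<omega> \<in> (\<lambda>t. Y t \<omega>) ` {0..}" using that by auto
    also have "\<dots> = {1..}"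
      using Y that by (simp add: fractional_linear_birth_process_def)
    finally show ?thesis by simp
  qed
  define S where "S t = (\<Sum>j = 1..k. real (k choose j) * ((-1) ^ (j - 1) * mittag_leffler \<nu> 1 (- (rate * real j) * t powr \<nu>)))" for t
  have S: "prob {\<omega> \<in> space M. Y t \<omega> \<le> k} = S t" if t: "0 < t" for t
  proof -
    \<comment> \<open>The union starts at 1 because paths never take the value 0.\<close>
    have "{\<omega> \<in> space M. Y t \<omega> \<le> k} = (\<Union>m\<in>{1..k}. {\<omega> \<in> space M. Y t \<omega> = m})"
      using ge1 t by fastforce
    also have "prob \<dots> = (\<Sum>m = 1..k. prob {\<omega> \<in> space M. Y t \<omega> = m})"
    proof (rule finite_measure_finite_Union)
      show "(\<lambda>m. {\<omega> \<in> space M. Y t \<omega> = m}) ` {1..k} \<subseteq> events"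
        using t by auto
    qed (auto simp: disjoint_family_on_def)
    also have "\<dots> = (\<Sum>m = 1..k. \<Sum>j = 1..m. real ((m - 1) choose (j - 1)) *
        ((-1) ^ (j - 1) * mittag_leffler \<nu> 1 (- (rate * real j) * t powr \<nu>)))"
      using Y t by (intro sum.cong) (simp_all add: fractional_linear_birth_process_def mult.assoc)
    also have "\<dots> = S t"
      unfolding S_def by (rule hockey_stick_weighted_sum)
    finally show ?thesis .
  qed
  have decreasing: "S t \<le> S s" if "0 < s" "s \<le> t" for s t
  proof -
    have "Y s \<omega> \<le> Y t \<omega>" if "\<omega> \<in> space M" for \<omega>
      using Y that \<open>0 < s\<close> \<open>s \<le> t\<close>
      by (intro mono_onD[of "{0..}" "\<lambda>t. Y t \<omega>"]) (auto simp: fractional_linear_birth_process_def)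
    then have "{\<omega> \<in> space M. Y t \<omega> \<le> k} \<subseteq> {\<omega> \<in> space M. Y s \<omega> \<le> k}"
      using order_trans by blast
    then have "prob {\<omega> \<in> space M. Y t \<omega> \<le> k} \<le> prob {\<omega> \<in> space M. Y s \<omega> \<le> k}"
      using that by (intro finite_measure_mono) auto
    then show ?thesis using that by (simp add: S)
  qed
  have "(S has_real_derivative (\<Sum>j = 1..k. real (k choose j) * ((-1) ^ (j - 1) *
      - (rate * real j * t powr (\<nu> - 1) * mittag_leffler \<nu> \<nu> (- (rate * real j) * t powr \<nu>))))) (at t)"
    unfolding S_def using \<open>0 < \<nu>\<close> True
    by (intro DERIV_sum DERIV_cmult mittag_leffler_powr_has_derivative)
  also have "(\<Sum>j = 1..k. real (k choose j) * ((-1) ^ (j - 1) *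
      - (rate * real j * t powr (\<nu> - 1) * mittag_leffler \<nu> \<nu> (- (rate * real j) * t powr \<nu>)))) =
      - birth_time_density \<nu> rate k t"
    using True by (simp add: birth_time_density_def sum_negf[symmetric] mult_ac)
  finally have D: "(S has_real_derivative - birth_time_density \<nu> rate k t) (at t)" .
  show ?thesis
  proof (rule ccontr)
    assume "\<not> ?thesis"
    then have "0 < - birth_time_density \<nu> rate k t" by simp
    from DERIV_pos_inc_right[OF D this] obtain d where "0 < d" "\<And>h. 0 < h \<Longrightarrow> h < d \<Longrightarrow> S t < S (t + h)"
      by blast
    from this(1) this(2)[of "d / 2"] decreasing[of t "t + d / 2"] True show False by simp
  qed
qed (simp add: birth_time_density_def)

lemma birth_time_density_laplace:
  fixes \<nu> rate x :: real
  assumes "0 < \<nu>" "0 < rate" "0 < x" "rate * real k < x powr \<nu>"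
  shows "(\<integral>t. birth_time_density \<nu> rate k t * exp (- x * t) \<partial>lborel) =
    (\<Sum>l = 1..k. real (k choose l) * (-1) ^ (l - 1) * (rate * real l) / (x powr \<nu> + rate * real l))"
proof -
  have "has_bochner_integral lborel
      (\<lambda>t. \<Sum>l = 1..k. real (k choose l) * (-1) ^ (l - 1) * (rate * real l) * (indicator {0<..} t *
         (t powr (\<nu> - 1) * mittag_leffler \<nu> \<nu> (- (rate * real l) * t powr \<nu>) * exp (- x * t))))
      (\<Sum>l = 1..k. real (k choose l) * (-1) ^ (l - 1) * (rate * real l) * (1 / (x powr \<nu> + rate * real l)))"
  proof (intro has_bochner_integral_sum has_bochner_integral_mult_right mittag_leffler_laplace)
    fix l assume l: "l \<in> {1..k}"
    then show "0 < rate * real l" using assms by simp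
    \<comment> \<open>The largest rate l = k decides whether all terms can be integrated
      termwise.\<close>
    have "rate * real l \<le> rate * real k" using l assms by simp
    with assms(4) show "rate * real l < x powr \<nu>" by (rule le_less_trans[rotated])
  qed (use assms in auto)
  moreover have "(\<Sum>l = 1..k. real (k choose l) * (-1) ^ (l - 1) * (rate * real l) * (indicator {0<..} t *
         (t powr (\<nu> - 1) * mittag_leffler \<nu> \<nu> (- (rate * real l) * t powr \<nu>) * exp (- x * t)))) =
       birth_time_density \<nu> rate k t * exp (- x * t)" for t
    by (cases "0 < t") (simp_all add: birth_time_density_def sum_distrib_left mult_ac)
  ultimately show ?thesis by (simp add: has_bochner_integral_iff)
qed

text \<open>The argument of z lies strictly between -pi/2 and pi/2, and multiplying it by \<nu> in
  [0, 1] keeps it there. This keeps the denominators z^\<nu> + rate l away from 0 on the right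
  half-plane.\<close>

lemma Re_powr_pos:
  assumes "0 < Re z" "0 \<le> \<nu>" "\<nu> \<le> 1"
  shows "0 < Re (z powr complex_of_real \<nu>)"
proof -
  have z: "z \<noteq> 0" using assms by auto
  have "\<bar>\<nu> * Im (Ln z)\<bar> \<le> 1 * \<bar>Im (Ln z)\<bar>"
    unfolding abs_mult using assms by (intro mult_right_mono) auto
  also have "\<dots> < pi / 2"
    using Re_Ln_pos_lt[OF z] assms by simp
  finally have "0 < cos (\<nu> * Im (Ln z))"
    by (intro cos_gt_zero_pi) auto
  then show ?thesis
    using z by (simp add: powr_def Re_exp)
qed

text \<open>Both sides are holomorphic on a disc inside the right half-plane that contains z and a
  real interval on which termwise integration is valid; the identity theorem does the rest.\<close>

lemma (in prob_space) laplace_transform_birth_time: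
  fixes \<phi> :: "'a \<Rightarrow> real" and z :: complex
  assumes "0 < \<nu>" "\<nu> \<le> 1" "0 < rate" and nonneg: "\<And>\<omega>. \<omega> \<in> space M \<Longrightarrow> 0 \<le> \<phi> \<omega>"
    and D: "distributed M lborel \<phi> (\<lambda>t. ennreal (birth_time_density \<nu> rate k t))"
    and f: "\<And>t. 0 \<le> birth_time_density \<nu> rate k t" and z: "0 < Re z"
  shows "(\<integral>\<omega>. exp (- z * of_real (\<phi> \<omega>)) \<partial>M) =
    (\<Sum>l = 1..k. of_nat (k choose l) * (-1) ^ (l - 1) * (of_real rate * of_nat l) /
       (z powr of_real \<nu> + of_real rate * of_nat l))" (is "?L z = ?R z")
proof -
  have [measurable]: "random_variable borel \<phi>"
    using distributed_measurable[OF D] by simp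
  have on_reals: "?L (of_real x) = ?R (of_real x)" if x: "0 < x" "rate * real k < x powr \<nu>" for x
  proof -
    have "?L (of_real x) = (\<integral>\<omega>. complex_of_real (exp (- x * \<phi> \<omega>)) \<partial>M)"
      by (simp add: exp_of_real[symmetric] del: exp_of_real)
    also have "\<dots> = of_real (\<integral>\<omega>. exp (- x * \<phi> \<omega>) \<partial>M)"
      by (rule integral_complex_of_real)
    also have "(\<integral>\<omega>. exp (- x * \<phi> \<omega>) \<partial>M) = (\<integral>t. birth_time_density \<nu> rate k t * exp (- x * t) \<partial>lborel)"
      by (rule distributed_integral[OF D, symmetric]) (use f in auto)
    also have "\<dots> = (\<Sum>l = 1..k. real (k choose l) * (-1) ^ (l - 1) * (rate * real l) / (x powr \<nu> + rate * real l))"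
      using assms x by (intro birth_time_density_laplace)
    also have "of_real \<dots> = ?R (of_real x)"
      using x by (simp add: powr_of_real)
    finally show ?thesis .
  qed
  \<comment> \<open>The solution of x^\<nu> = rate k, beyond which termwise integration
    applies.\<close>
  define x0 where "x0 = (rate * real k) powr (1 / \<nu>)"
  have x0: "0 < x \<and> rate * real k < x powr \<nu>" if "x0 < x" for x
  proof -
    have "rate * real k = x0 powr \<nu>"
      using assms by (simp add: x0_def powr_powr)
    also have "\<dots> < x powr \<nu>"
      using assms that by (intro powr_less_mono2) (auto simp: x0_def)
    finally have "rate * real k < x powr \<nu>" .
    moreover have "0 \<le> x0" by (simp add: x0_def)
    ultimately show ?thesis using that by simp
  qed
  \<comment> \<open>The condition |a - z| < a amounts to |z|^2 < 2 a Re z, which explains the second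
    entry; the first puts the centre beyond \<open>x0\<close>.\<close>
  define a where "a = max (x0 + 1) ((cmod z)\<^sup>2 / (2 * Re z) + 1)"
  have a: "x0 < a" "0 < a"
    using x0[of a] by (auto simp: a_def)
  have "(cmod z)\<^sup>2 / (2 * Re z) < a" by (simp add: a_def)
  then have "(cmod z)\<^sup>2 < 2 * Re z * a"
    using z by (simp add: divide_less_eq mult_ac)
  then have "(cmod (of_real a - z))\<^sup>2 < a\<^sup>2"
    by (simp add: cmod_power2 power2_diff algebra_simps)
  then have zb: "z \<in> ball (of_real a) a"
    using a by (simp add: dist_norm power2_less_imp_less)
  have Rb: "0 < Re w" if "w \<in> ball (complex_of_real a) a" for w
    using that abs_Re_le_cmod[of "of_real a - w"] by (simp add: dist_norm)
  have nr: "w \<notin> \<real>\<^sub>\<le>\<^sub>0" if "w \<in> ball (complex_of_real a) a" for w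
    using Rb[OF that] by (simp add: complex_nonpos_Reals_iff)
  have nz: "w powr of_real \<nu> + of_real rate * of_nat l \<noteq> 0" if "w \<in> ball (complex_of_real a) a" for w l
  proof -
    have "0 < Re (w powr of_real \<nu>)" using Re_powr_pos[OF Rb[OF that]] assms by simp
    then have "0 < Re (w powr of_real \<nu> + of_real rate * of_nat l)"
      using assms by (simp add: add_pos_nonneg)
    then show ?thesis by (metis less_irrefl zero_complex.sel(1))
  qed
  \<comment> \<open>The real interval (a, 2a) lies in the disc and beyond \<open>x0\<close>, and it
    accumulates at the centre.\<close>
  have "?L z - ?R z = 0"
  proof (rule analytic_continuation[where f = "\<lambda>w. ?L w - ?R w" and S = "ball (complex_of_real a) a"
        and U = "complex_of_real ` {a<..<2 * a}" and \<xi> = "complex_of_real a"])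
    show "(\<lambda>w. ?L w - ?R w) holomorphic_on ball (complex_of_real a) a"
      using nonneg nr nz by (intro holomorphic_intros laplace_transform_holomorphic) auto
    show "complex_of_real ` {a<..<2 * a} \<subseteq> ball (complex_of_real a) a"
      by (auto simp: dist_of_real dist_real_def)
    show "complex_of_real a islimpt complex_of_real ` {a<..<2 * a}"
      unfolding islimpt_approachable
    proof (intro allI impI)
      fix e :: real assume e: "0 < e"
      define d where "d = min (e / 2) (a / 2)"
      have "0 < d" "d < e" "d < a" using e a by (auto simp: d_def)
      then show "\<exists>x'\<in>complex_of_real ` {a<..<2 * a}. x' \<noteq> complex_of_real a \<and> dist x' (complex_of_real a) < e"
        by (intro bexI[of _ "complex_of_real (a + d)"] imageI)
           (auto simp: dist_norm)
    qed
    show "?L w - ?R w = 0" if "w \<in> complex_of_real ` {a<..<2 * a}" for w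
      using that on_reals x0 a by auto
  qed (use a zb in auto)
  then show ?thesis by simp
qed

text \<open>Writing l / (w + l) = 1 - w / (w + l) leaves an alternating sum of binomials, which
  vanishes for k >= 1, and w times the partial fraction sum; this w cancels the first factor of
  \<open>pochhammer w (Suc k)\<close>.\<close>

lemma alternating_binomial_sum_pochhammer:
  fixes w :: complex
  assumes "0 < Re w" "1 \<le> k"
  shows "(\<Sum>l = 1..k. of_nat (k choose l) * (-1) ^ (l - 1) * of_nat l / (w + of_nat l)) =
    fact k / pochhammer (w + 1) k"
proof -
  have nz: "w + of_nat l \<noteq> 0" for l
  proof -
    have "0 < Re (w + of_nat l)" using assms by simp
    then show ?thesis by (metis less_irrefl zero_complex.sel(1))
  qed
  have w0: "w \<noteq> 0" using nz[of 0] by simp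
  have "(\<Sum>l = 1..k. of_nat (k choose l) * (-1) ^ (l - 1) * of_nat l / (w + of_nat l)) =
     (\<Sum>l = 1..k. w * ((-1) ^ l * of_nat (k choose l) / (w + of_nat l)) - (-1) ^ l * of_nat (k choose l))"
  proof (rule sum.cong[OF refl])
    fix l assume "l \<in> {1..k}"
    then have l: "(-1) ^ (l - 1) = - ((-1) ^ l :: complex)" by (cases l) auto
    show "of_nat (k choose l) * (-1) ^ (l - 1) * of_nat l / (w + of_nat l) =
       w * ((-1) ^ l * of_nat (k choose l) / (w + of_nat l)) - (-1) ^ l * of_nat (k choose l)"
      unfolding l using nz[of l] by (simp add: divide_simps) (simp add: algebra_simps)
  qed
  \<comment> \<open>The added index 0 contributes w (1/w) - 1 = 0.\<close>
  also have "\<dots> = (\<Sum>l\<le>k. w * ((-1) ^ l * of_nat (k choose l) / (w + of_nat l)) - (-1) ^ l * of_nat (k choose l))"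
    using w0 by (simp add: atMost_atLeast0 sum.atLeast_Suc_atMost[of 0])
  also have "\<dots> = w * (\<Sum>l\<le>k. (-1) ^ l * of_nat (k choose l) / (w + of_nat l)) - (\<Sum>l\<le>k. (-1) ^ l * of_nat (k choose l))"
    by (simp add: sum_subtractf sum_distrib_left)
  also have "\<dots> = fact k / pochhammer (w + 1) k"
    using w0 choose_alternating_sum[of k, where 'a = complex] assms(2)
    unfolding alternating_binomial_partial_fractions[OF nz] pochhammer_rec by simp
  finally show ?thesis .
qed

theorem mainTheorem10:
  fixes M :: "'a measure"
    and \<nu> rate\<^sub>\<alpha> rate\<^sub>\<beta> :: real and k n :: nat and u :: complex
    and Y N :: "real \<Rightarrow> 'a \<Rightarrow> nat" and \<phi> :: "'a \<Rightarrow> real"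
  assumes "prob_space M"
    and "0 < \<nu>" and "\<nu> \<le> 1" and "0 < rate\<^sub>\<alpha>" and "0 < rate\<^sub>\<beta>" and "1 \<le> k"
    and "prob_space.fractional_linear_birth_process M \<nu> rate\<^sub>\<beta> Y"
    and "n = k \<or> n = k + 1"  \<comment> \<open>level \<open>k\<close> counted with or without the progenitor\<close>
    and "\<phi> = hitting_time Y n"
    and "distributed M lborel \<phi> (\<lambda>t. ennreal (birth_time_density \<nu> rate\<^sub>\<beta> k t))"
    and "prob_space.poisson_process M rate\<^sub>\<alpha> N"
    and "prob_space.indep_processes M N Y"
    and "cmod u < 1"
  shows "(\<integral>\<omega>. u ^ N (\<phi> \<omega>) \<omega> \<partial>M) =
           fact k * Gamma (of_real (rate\<^sub>\<alpha> powr \<nu>) * (1 - u) powr of_real \<nu> / of_real rate\<^sub>\<beta> + 1) /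
             Gamma (of_real (rate\<^sub>\<alpha> powr \<nu>) * (1 - u) powr of_real \<nu> / of_real rate\<^sub>\<beta> + 1 + of_nat k)
       \<and> (\<integral>\<omega>. u ^ N (\<phi> \<omega>) \<omega> \<partial>M) =
           of_nat k * Beta (of_nat k)
             (of_real (rate\<^sub>\<alpha> powr \<nu>) * (1 - u) powr of_real \<nu> / of_real rate\<^sub>\<beta> + 1)"
proof -
  interpret prob_space M by fact
  note \<nu> = assms(2,3) and rates = assms(4,5) and k = assms(6) and Y = assms(7) and \<phi> = assms(9)
  have n: "1 \<le> n" using assms(6,8) by auto
  have nonneg: "0 \<le> \<phi> \<omega>" if "\<omega> \<in> space M" for \<omega>
    unfolding \<phi> using birth_hitting_time(1)[OF Y n that] .
  define z where "z = of_real rate\<^sub>\<alpha> * (1 - u)"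
  define w where "w = of_real (rate\<^sub>\<alpha> powr \<nu>) * (1 - u) powr of_real \<nu> / of_real rate\<^sub>\<beta>"
  have Rez: "0 < Re z"
    using rates complex_Re_le_cmod[of u] assms(13) by (simp add: z_def)
  \<comment> \<open>The principal power splits because one of the two factors, the Poisson rate, is
    a positive real.\<close>
  have zw: "z powr of_real \<nu> = of_real rate\<^sub>\<beta> * w"
    using rates by (simp add: z_def w_def powr_times_real_left powr_of_real)
  have Rew: "0 < Re w"
    using Re_powr_pos[OF Rez, of \<nu>] \<nu> rates unfolding zw by (simp add: zero_less_mult_iff)
  have "(\<integral>\<omega>. u ^ N (\<phi> \<omega>) \<omega> \<partial>M) = (\<integral>\<omega>. exp (- z * of_real (\<phi> \<omega>)) \<partial>M)"
    unfolding z_def using assms(13) \<phi> hitting_time_indep[OF Y n assms(12)]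
    by (intro pgf_at_independent_time[OF assms(11) rates(1) _ nonneg]) auto
  also have "\<dots> = (\<Sum>l = 1..k. of_nat (k choose l) * (-1) ^ (l - 1) * (of_real rate\<^sub>\<beta> * of_nat l) /
       (z powr of_real \<nu> + of_real rate\<^sub>\<beta> * of_nat l))"
    by (rule laplace_transform_birth_time[OF \<nu> rates(2) nonneg assms(10) birth_time_density_nonneg[OF Y \<nu>(1)] Rez])
  also have "\<dots> = (\<Sum>l = 1..k. of_nat (k choose l) * (-1) ^ (l - 1) * of_nat l / (w + of_nat l))"
    using rates unfolding zw distrib_left[symmetric] by (intro sum.cong) auto
  also have "\<dots> = fact k / pochhammer (w + 1) k"
    using Rew k by (rule alternating_binomial_sum_pochhammer)
  also have "\<dots> = fact k * Gamma (w + 1) / Gamma (w + 1 + of_nat k)"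
  proof -
    \<comment> \<open>Off the poles of Gamma the Pochhammer symbol is a quotient of Gamma
      values.\<close>
    have "w + 1 \<notin> \<int>\<^sub>\<le>\<^sub>0"
      using Rew by (auto elim!: nonpos_Ints_cases' simp: complex_eq_iff)
    then show ?thesis by (simp add: pochhammer_Gamma)
  qed
  finally have E: "(\<integral>\<omega>. u ^ N (\<phi> \<omega>) \<omega> \<partial>M) = fact k * Gamma (w + 1) / Gamma (w + 1 + of_nat k)" .
  have "fact k = of_nat k * Gamma (of_nat k :: complex)"
    using k Gamma_fact[of "k - 1", where 'a = complex] by (cases k) auto
  then have "fact k * Gamma (w + 1) / Gamma (w + 1 + of_nat k) = of_nat k * Beta (of_nat k) (w + 1)"
    by (simp add: Beta_def add_ac)
  with E show ?thesis unfolding w_def by simp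
qed

end
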